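(* Let $K,L\subset\mathbb{E}^n$ be convex bodies containing the origin in their interiors, $Q\subset\mathbb{E}^n$ a convex body, $p>1$, $t$ an integer with $0<t<n-1$, and $\phi\in SL(n)$. Then $$V_{p,t}(\phi K,L,\phi Q)=V_{p,t}(K,\phi^{-1}L,Q).$$
   Context: A convex body is a compact convex subset of $\mathbb{E}^n$ with nonempty interior; $h_K$ is the support function. For convex bodies $K_1,\dots,K_{n-1}$ the mixed area measure $S(K_1,\dots,K_{n-1};\cdot)$ is the Borel measure on $S^{n-1}$ with $V(K_1,\dots,K_{n-1},M)=\frac1n\int h_M\,dS(K_1,\dots,K_{n-1};\cdot)$ for all convex bodies $M$; $S(K,t;Q,n-t-1;\cdot)$ has $K$ repeated $t$ times and $Q$ repeated $n-t-1$ times. For $K$ containing the origin in its interior, $dS_{p,t}(K,Q;\cdot)=h_K^{1-p}\,dS(K,t;Q,n-t-1;\cdot)$, and $V_{p,t}(K,L,Q)=\frac1n\int_{S^{n-1}}h_L^p\,dS_{p,t}(K,Q;\cdot)$ (equivalently $\frac{p}{t+1}\lim_{\varepsilon\to0^+}\frac{V(K+_p\varepsilon\cdot L,t+1;Q,n-t-1)-V(K,t+1;Q,n-t-1)}{\varepsilon}$, where $h^p_{K+_p\varepsilon\cdot L}=h_K^p+\varepsilon h_L^p$ and $V(K,s;Q,n-s)$ is the mixed volume with $K$ repeated $s$ times). *)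

theory Defs
  imports "HOL-Analysis.Analysis"
begin

text \<open>Convex bodies in E^n, modelled as subsets of real^'n (n = CARD('n)).\<close>

definition convex_body :: "(real^'n) set \<Rightarrow> bool" where
  "convex_body K \<longleftrightarrow> compact K \<and> convex K \<and> interior K \<noteq> {}"

text \<open>Support function h_K.\<close>
definition support_fun :: "(real^'n) set \<Rightarrow> real^'n \<Rightarrow> real" where
  "support_fun K u = (SUP x\<in>K. x \<bullet> u)"

text \<open>Minkowski sum of the family K i, i in S.\<close>
definition minkowski_sum :: "nat set \<Rightarrow> (nat \<Rightarrow> (real^'n) set) \<Rightarrow> (real^'n) set" where
  "minkowski_sum S K = {y. \<exists>x. (\<forall>i\<in>S. x i \<in> K i) \<and> y = (\<Sum>i\<in>S. x i)}"

text \<open>Mixed volume V(K 0, ..., K (n-1)) via the standard polarization (inclusion-exclusion)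
  formula for the volume of Minkowski sums.\<close>
definition mixed_volume :: "(nat \<Rightarrow> (real^'n) set) \<Rightarrow> real" where
  "mixed_volume K =
     (1 / fact CARD('n)) *
     (\<Sum>S\<in>Pow {..<CARD('n)} - {{}}.
        (-1) ^ (CARD('n) - card S) * measure lebesgue (minkowski_sum S K))"

text \<open>V(K,s;Q,n-s): K repeated s times, Q repeated n-s times.\<close>
definition mixed_volume2 :: "(real^'n) set \<Rightarrow> nat \<Rightarrow> (real^'n) set \<Rightarrow> real" where
  "mixed_volume2 K s Q = mixed_volume (\<lambda>i. if i < s then K else Q)"

text \<open>L_p combination K +_p eps.L: the convex body whose support function is
  (h_K^p + eps h_L^p)^(1/p) (written as the Wulff shape of this sublinear function).\<close>
definition lp_comb :: "real \<Rightarrow> (real^'n) set \<Rightarrow> real \<Rightarrow> (real^'n) set \<Rightarrow> (real^'n) set" where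
  "lp_comb p K \<epsilon> L =
     {x. \<forall>u. x \<bullet> u \<le> (support_fun K u powr p + \<epsilon> * support_fun L u powr p) powr (1 / p)}"

text \<open>The L_p mixed quermassintegral-type quantity V_{p,t}(K,L,Q), via the first variation
  formula given in the paper.\<close>
definition V_pt :: "real \<Rightarrow> nat \<Rightarrow> (real^'n) set \<Rightarrow> (real^'n) set \<Rightarrow> (real^'n) set \<Rightarrow> real" where
  "V_pt p t K L Q =
     p / real (t + 1) *
     Lim (at_right 0)
       (\<lambda>\<epsilon>. (mixed_volume2 (lp_comb p K \<epsilon> L) (t + 1) Q - mixed_volume2 K (t + 1) Q) / \<epsilon>)"

end

(*
  A linear map of determinant 1 preserves Lebesgue measure and commutes with Minkowski sums,
  so it preserves mixed volumes. Since h_{\<phi>K}(u) = h_K(\<phi>^T u), the L_p combination is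
  covariant: \<phi>K +_p \<epsilon>L = \<phi>(K +_p \<epsilon>\<phi>^{-1}L). Hence the difference quotients defining
  both sides of the identity agree for every \<epsilon>, and so do their limits.
*)

theory Submission
  imports Defs
begin

lemma
  fixes A :: "'a::semiring_1^'n^'n"
  assumes "invertible A"
  shows matrix_inv_right: "A ** matrix_inv A = mat 1"
    and matrix_inv_left: "matrix_inv A ** A = mat 1"
  using someI_ex [OF assms [unfolded invertible_def]] by (simp_all add: matrix_inv_def)

lemma measure_linear_image_not_inj_cart:
  fixes f :: "real^'n \<Rightarrow> real^'n"
  assumes "linear f" "\<not> inj f"
  shows "f ` S \<in> lmeasurable \<and> measure lebesgue (f ` S) = \<bar>det (matrix f)\<bar> * measure lebesgue S"
proof -
  have "negligible (f ` S)"
    using assms by (rule negligible_linear_singular_image)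
  moreover have "det (matrix f) = 0"
    using assms det_nz_iff_inj by blast
  ultimately show ?thesis
    by (simp add: negligible_iff_measure)
qed

lemma measure_coordinate_swap_image:
  fixes S :: "(real^'n) set" and m n :: 'n
  assumes "S \<in> lmeasurable"
  defines "f \<equiv> \<lambda>x. \<chi> i. x $ Transposition.transpose m n i"
  shows "f ` S \<in> lmeasurable \<and> measure lebesgue (f ` S) = \<bar>det (matrix f)\<bar> * measure lebesgue S"
proof -
  have "linear f"
    unfolding f_def by (rule linearI) (simp_all add: vec_eq_iff)
  have "matrix f = (\<chi> i. mat 1 $ Transposition.transpose m n i)"
    by (simp add: f_def matrix_def vec_eq_iff axis_def mat_def)
  then have det: "\<bar>det (matrix f)\<bar> = 1"
    by (simp add: det_permute_rows permutes_swap_id sign_swap_id)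
  have box: "f ` cbox a b = cbox (f a) (f b)" for a b
    by (auto simp: f_def image_iff mem_box_cart lambda_swap_Galois) (metis transpose_involutory)+
  have "measure lebesgue (f ` cbox a b) = measure lebesgue (cbox a b)" for a b
  proof (cases "cbox a b = {}")
    case False
    then have "cbox (f a) (f b) \<noteq> {}"
      using box by auto
    then have "measure lebesgue (f ` cbox a b) = (\<Prod>i\<in>UNIV. (b - a) $ Transposition.transpose m n i)"
      unfolding box by (simp add: content_cbox_cart f_def)
    also have "\<dots> = (\<Prod>i\<in>UNIV. (b - a) $ i)"
      using prod.permute [OF permutes_swap_id, where S=UNIV and g="\<lambda>i. (b - a) $ i"] by (simp add: o_def)
    finally show ?thesis
      using False by (simp add: content_cbox_cart)
  qed simp
  then show ?thesis
    using measure_linear_sufficient [OF \<open>linear f\<close> assms(1), of 1] det by simp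
qed

lemma measure_shear_image:
  fixes S :: "(real^'n) set" and m n :: 'n
  assumes "m \<noteq> n" "S \<in> lmeasurable"
  defines "f \<equiv> \<lambda>x. \<chi> i. if i = m then x $ m + x $ n else x $ i"
  shows "f ` S \<in> lmeasurable \<and> measure lebesgue (f ` S) = \<bar>det (matrix f)\<bar> * measure lebesgue S"
proof -
  have "linear f"
    unfolding f_def by (rule linearI) (auto simp: vec_eq_iff algebra_simps)
  have "matrix f = (\<chi> k. if k = m then row m (mat 1) + 1 *s row n (mat 1) else row k (mat 1))"
    by (auto simp: f_def matrix_def vec_eq_iff row_def axis_def mat_def)
  then have det: "det (matrix f) = 1"
    using det_row_operation [OF assms(1), where c=1 and A="mat 1"] by simp
  have "measure lebesgue (f ` cbox a b) = measure lebesgue (cbox a b)" for a b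
  proof (cases "cbox a b = {}")
    case False
    \<comment> \<open>measure_shear_interval needs a nonnegative n-th lower corner, so translate along axis n\<close>
    define v where "v = axis n (a $ n)"
    have shift: "cbox a b = (+) v ` cbox (a - v) (b - v)"
      using cbox_translation [of v "a - v" "b - v"] by simp
    then have "f ` cbox a b = (+) (f v) ` f ` cbox (a - v) (b - v)"
      by (simp add: image_comp o_def linear_add [OF \<open>linear f\<close>])
    then have "measure lebesgue (f ` cbox a b) = measure lebesgue (f ` cbox (a - v) (b - v))"
      by (simp add: measure_translation)
    also have "\<dots> = measure lebesgue (cbox (a - v) (b - v))"
      unfolding f_def
      by (rule measure_shear_interval) (use False shift assms(1) in \<open>auto simp: v_def\<close>)
    also have "\<dots> = measure lebesgue (cbox a b)"
      by (simp add: shift measure_translation)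
    finally show ?thesis .
  qed simp
  then show ?thesis
    using measure_linear_sufficient [OF \<open>linear f\<close> assms(2), of 1] det by simp
qed

(* The library's measure_linear_image asks for a well-ordered index type; the reduction to
   elementary matrices works over any finite one. *)
lemma measure_linear_image_cart:
  fixes f :: "real^'n \<Rightarrow> real^'n"
  assumes "linear f" "S \<in> lmeasurable"
  shows "f ` S \<in> lmeasurable \<and> measure lebesgue (f ` S) = \<bar>det (matrix f)\<bar> * measure lebesgue S"
proof -
  have "\<forall>S \<in> lmeasurable. f ` S \<in> lmeasurable
          \<and> measure lebesgue (f ` S) = \<bar>det (matrix f)\<bar> * measure lebesgue S"
  proof (rule induct_linear_elementary [OF \<open>linear f\<close>]; intro ballI)
    fix f g :: "real^'n \<Rightarrow> real^'n" and S :: "(real^'n) set"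
    assume "linear f" "linear g" "S \<in> lmeasurable"
      and f: "\<forall>S \<in> lmeasurable. f ` S \<in> lmeasurable
                \<and> measure lebesgue (f ` S) = \<bar>det (matrix f)\<bar> * measure lebesgue S"
      and g: "\<forall>S \<in> lmeasurable. g ` S \<in> lmeasurable
                \<and> measure lebesgue (g ` S) = \<bar>det (matrix g)\<bar> * measure lebesgue S"
    then have gS: "g ` S \<in> lmeasurable"
      "measure lebesgue (g ` S) = \<bar>det (matrix g)\<bar> * measure lebesgue S"
      by blast+
    then have "f ` g ` S \<in> lmeasurable"
      "measure lebesgue (f ` g ` S) = \<bar>det (matrix f)\<bar> * measure lebesgue (g ` S)"
      using f by blast+
    then show "(f \<circ> g) ` S \<in> lmeasurable
          \<and> measure lebesgue ((f \<circ> g) ` S) = \<bar>det (matrix (f \<circ> g))\<bar> * measure lebesgue S"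
      unfolding image_comp [symmetric] matrix_compose [OF \<open>linear g\<close> \<open>linear f\<close>]
      by (simp add: gS det_mul abs_mult)
  next
    fix f :: "real^'n \<Rightarrow> real^'n" and i and S :: "(real^'n) set"
    assume "linear f" "\<And>x. f x $ i = 0"
    then have "\<not> inj f"
      by (metis linear_injective_imp_surjective one_neq_zero surjE vec_component)
    with \<open>linear f\<close> show "f ` S \<in> lmeasurable
          \<and> measure lebesgue (f ` S) = \<bar>det (matrix f)\<bar> * measure lebesgue S"
      by (rule measure_linear_image_not_inj_cart)
  next
    fix c :: "'n \<Rightarrow> real" and S :: "(real^'n) set"
    assume "S \<in> lmeasurable"
    then show "(\<lambda>x. \<chi> i. c i * x $ i) ` S \<in> lmeasurable
          \<and> measure lebesgue ((\<lambda>x. \<chi> i. c i * x $ i) ` S)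
            = \<bar>det (matrix (\<lambda>x. \<chi> i. c i * x $ i))\<bar> * measure lebesgue S"
      by (simp add: measurable_stretch measure_stretch matrix_def axis_def det_diagonal)
  qed (simp_all add: measure_coordinate_swap_image measure_shear_image)
  with assms(2) show ?thesis
    by blast
qed

lemma measure_not_fmeasurable:
  assumes "A \<notin> fmeasurable M"
  shows "measure M A = 0"
proof (cases "A \<in> sets M")
  case True
  with assms have "emeasure M A = top"
    by (simp add: fmeasurable_def less_top [symmetric])
  then show ?thesis
    by (rule measure_zero_top)
qed (rule measure_notin_sets)

lemma measure_invertible_matrix_image:
  fixes A :: "real^'n^'n"
  assumes "invertible A"
  shows "measure lebesgue ((*v) A ` S) = \<bar>det A\<bar> * measure lebesgue S"
proof (cases "S \<in> lmeasurable")
  case True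
  then show ?thesis
    using measure_linear_image_cart [OF matrix_vector_mul_linear True] by simp
next
  case False
  have "(*v) (matrix_inv A) ` (*v) A ` S = S"
    using assms by (simp add: image_comp o_def matrix_vector_mul_assoc matrix_inv_left)
  then have "(*v) A ` S \<notin> lmeasurable"
    using False measure_linear_image_cart [OF matrix_vector_mul_linear] by metis
  with False show ?thesis
    by (simp add: measure_not_fmeasurable)
qed

lemma minkowski_sum_linear_image:
  assumes "linear f"
  shows "minkowski_sum I (\<lambda>i. f ` K i) = f ` minkowski_sum I K"
proof
  show "minkowski_sum I (\<lambda>i. f ` K i) \<subseteq> f ` minkowski_sum I K"
  proof
    fix y
    assume "y \<in> minkowski_sum I (\<lambda>i. f ` K i)"
    then obtain x where x: "\<forall>i\<in>I. x i \<in> f ` K i" and y: "y = (\<Sum>i\<in>I. x i)"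
      unfolding minkowski_sum_def by blast
    from x have "\<forall>i\<in>I. \<exists>g. g \<in> K i \<and> x i = f g"
      by blast
    then obtain g where g: "\<forall>i\<in>I. g i \<in> K i \<and> x i = f (g i)"
      by (rule bchoice [THEN exE]) blast
    then have "y = f (\<Sum>i\<in>I. g i)"
      by (simp add: y linear_sum [OF assms])
    with g show "y \<in> f ` minkowski_sum I K"
      unfolding minkowski_sum_def by blast
  qed
  show "f ` minkowski_sum I K \<subseteq> minkowski_sum I (\<lambda>i. f ` K i)"
  proof
    fix y
    assume "y \<in> f ` minkowski_sum I K"
    then obtain x where "\<forall>i\<in>I. x i \<in> K i" and "y = f (\<Sum>i\<in>I. x i)"
      unfolding minkowski_sum_def by blast
    then show "y \<in> minkowski_sum I (\<lambda>i. f ` K i)"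
      unfolding minkowski_sum_def by (auto simp: linear_sum [OF assms] intro!: exI [of _ "\<lambda>i. f (x i)"])
  qed
qed

lemma mixed_volume_invertible_image:
  fixes A :: "real^'n^'n"
  assumes "invertible A"
  shows "mixed_volume (\<lambda>i. (*v) A ` K i) = \<bar>det A\<bar> * mixed_volume K"
  unfolding mixed_volume_def minkowski_sum_linear_image [OF matrix_vector_mul_linear]
    measure_invertible_matrix_image [OF assms]
  by (simp add: sum_distrib_left algebra_simps)

lemma mixed_volume2_invertible_image:
  fixes A :: "real^'n^'n"
  assumes "invertible A"
  shows "mixed_volume2 ((*v) A ` K) s ((*v) A ` Q) = \<bar>det A\<bar> * mixed_volume2 K s Q"
proof -
  have "(\<lambda>i. if i < s then (*v) A ` K else (*v) A ` Q) = (\<lambda>i. (*v) A ` (if i < s then K else Q))"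
    by (simp add: fun_eq_iff)
  then show ?thesis
    by (simp add: mixed_volume2_def mixed_volume_invertible_image [OF assms])
qed

lemma inner_matrix_vector_mul_transpose:
  fixes A :: "real^'n^'m"
  shows "(A *v x) \<bullet> u = x \<bullet> (transpose A *v u)"
  by (metis dot_lmul_matrix inner_commute transpose_matrix_vector)

lemma support_fun_matrix_image:
  "support_fun ((*v) A ` X) u = support_fun X (transpose A *v u)"
  by (simp add: support_fun_def image_image inner_matrix_vector_mul_transpose)

lemma lp_comb_invertible_image:
  fixes A :: "real^'n^'n"
  assumes "invertible A"
  shows "lp_comb p ((*v) A ` K) \<epsilon> L = (*v) A ` lp_comb p K \<epsilon> ((*v) (matrix_inv A) ` L)"
proof -
  let ?B = "matrix_inv A"
  have AB: "A ** ?B = mat 1" and BA: "?B ** A = mat 1"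
    using assms by (rule matrix_inv_right, rule matrix_inv_left)
  have tAB: "transpose A *v (transpose ?B *v v) = v" for v
    by (simp only: matrix_vector_mul_assoc matrix_transpose_mul [symmetric] BA transpose_mat
        matrix_vector_mul_lid)
  have tBA: "transpose ?B *v (transpose A *v u) = u" for u
    by (simp only: matrix_vector_mul_assoc matrix_transpose_mul [symmetric] AB transpose_mat
        matrix_vector_mul_lid)
  define P where "P x u \<longleftrightarrow> x \<bullet> u \<le>
    (support_fun K (transpose A *v u) powr p + \<epsilon> * support_fun L u powr p) powr (1 / p)" for x u
  have "x \<in> lp_comb p ((*v) A ` K) \<epsilon> L \<longleftrightarrow> (\<forall>u. P x u)" for x
    by (simp add: lp_comb_def P_def support_fun_matrix_image del: transpose_matrix_vector)
  moreover have "?B *v x \<in> lp_comb p K \<epsilon> ((*v) ?B ` L) \<longleftrightarrow> (\<forall>v. P x (transpose ?B *v v))" for x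
    by (simp add: lp_comb_def P_def support_fun_matrix_image inner_matrix_vector_mul_transpose tAB
        del: transpose_matrix_vector)
  moreover have "(\<forall>v. P x (transpose ?B *v v)) \<longleftrightarrow> (\<forall>u. P x u)" for x
    by (metis tBA)
  ultimately have "x \<in> lp_comb p ((*v) A ` K) \<epsilon> L \<longleftrightarrow> ?B *v x \<in> lp_comb p K \<epsilon> ((*v) ?B ` L)" for x
    by blast
  moreover have "x \<in> (*v) A ` S \<longleftrightarrow> ?B *v x \<in> S" for x S
    by (metis (no_types, lifting) AB BA image_iff matrix_vector_mul_assoc matrix_vector_mul_lid)
  ultimately show ?thesis
    by blast
qed

(* Only for |det A| = 1: a factor |det A| could not be moved out of Lim without knowing that
   the limit exists. *)
lemma V_pt_unimodular_image:
  fixes A :: "real^'n^'n"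
  assumes "\<bar>det A\<bar> = 1"
  shows "V_pt p t ((*v) A ` K) L ((*v) A ` Q) = V_pt p t K ((*v) (matrix_inv A) ` L) Q"
proof -
  have "invertible A"
    using assms by (simp add: invertible_det_nz)
  then show ?thesis
    unfolding V_pt_def lp_comb_invertible_image [OF \<open>invertible A\<close>]
      mixed_volume2_invertible_image [OF \<open>invertible A\<close>] assms
    by simp
qed

theorem lemma4:
  fixes K L Q :: "(real^'n) set" and \<phi> :: "real^'n^'n" and p :: real and t :: nat
  assumes "convex_body K" and "0 \<in> interior K"
    and "convex_body L" and "0 \<in> interior L"
    and "convex_body Q"
    and "p > 1"
    and "0 < t" and "t < CARD('n) - 1"
    and "det \<phi> = 1"
  shows "V_pt p t ((\<lambda>x. \<phi> *v x) ` K) L ((\<lambda>x. \<phi> *v x) ` Q)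
         = V_pt p t K ((\<lambda>x. matrix_inv \<phi> *v x) ` L) Q"
  using V_pt_unimodular_image [of \<phi>] \<open>det \<phi> = 1\<close> by simp

end
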